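(* The following statements about the real field $\mathbb{R}$ are equivalent, where AP denotes the Archimedean Principle: for any $x>0$ and any $y>0$, there exists $N\in\mathbb{N}$ such that $N>\frac{x}{y}$. (1) [AP & weak NIP] The conjunction of AP and the Weak Nested Intervals Principle: if $(I_k)_{k\in\mathbb{N}}$ is a sequence of nested intervals and $\lim_{k\to\infty}\ell(I_k)=0$, then $\bigcap_{k=1}^\infty I_k\neq\emptyset$. (2) The unit interval $[0,1]$ is compact. (3) [AP & LCL] The conjunction of AP and the Lebesgue Covering Lemma: every open cover of a closed and bounded interval has a Lebesgue number. (4) [AP & UCT] The conjunction of AP and the Uniform Continuity Theorem: if $f$ is continuous on $[a,b]$, then $f$ is uniformly continuous. (5) [UAS] Uniform Approximation by Step Functions: if $f$ is continuous on $[a,b]$, then for each $\varepsilon>0$, there exists a step function $\varphi:[a,b]\to\mathbb{R}$ such that for any $x\in[a,b]$, we have $|f(x)-\varphi(x)|<\varepsilon$. (6) [CC & BVT] The conjunction of the Countable Cofinality of $\mathbb{R}$: there exists a countably infinite cofinal subset of $\mathbb{R}$; and the Bounded Value Theorem: if $f$ is continuous on $[a,b]$, then there exists $M\in\mathbb{R}$ such that $a\le x\le b$ implies $f(x)\le M$. (7) [MCP] Monotone Convergence Principle: a monotonically increasing sequence that is bounded above is convergent.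
   Context: The setting is the real field $\mathbb{R}$; any one of the listed principles may be chosen as the completeness axiom for $\mathbb{R}$, and equivalence means that each principle is derived from each other one. $\mathbb{N}=\{1,2,3,\dots\}$. A sequence is a function $\mathbb{N}\to\mathbb{R}$, $(c_n)_{n\in\mathbb{N}}$; it is monotonically increasing if $c_n\le c_{n+1}$ for all $n$, bounded above if some $M\in\mathbb{R}$ satisfies $c_n\le M$ for all $n$, and converges to $c\in\mathbb{R}$ if for every $\varepsilon>0$ there is $N\in\mathbb{N}$ with $|c_n-c|<\varepsilon$ for all $n\ge N$ (convergent: converges to some $c\in\mathbb{R}$). A sequence of nested intervals is a sequence $(I_k)_{k\in\mathbb{N}}$ of nonempty closed and bounded intervals $I_k=[a_k,b_k]$ with $I_{k+1}\subseteq I_k$ for all $k$; $\ell([a,b])=b-a$. A subset $S\subseteq\mathbb{R}$ is cofinal if for each $x\in\mathbb{R}$ there is $N\in S$ with $N>x$. $G\subseteq\mathbb{R}$ is open if for every $x\in G$ there is a bounded open interval $(u,v)$ with $x\in(u,v)\subseteq G$. An open cover of $S\subseteq\mathbb{R}$ is a collection of open sets whose union contains $S$; $S$ is compact if every open cover of $S$ has a finite subcollection that still covers $S$. A Lebesgue number of an open cover $\mathscr{C}$ of $S$ is a $\delta>0$ such that for any $x,c\in S$, if $|x-c|<\delta$, then there exists $G\in\mathscr{C}$ such that $x,c\in G$. A function $f:I\to\mathbb{R}$ is continuous on $I$ if for each $c\in I$ and $\varepsilon>0$ there is $\delta>0$ such that $x\in I$, $|x-c|<\delta$ imply $|f(x)-f(c)|<\varepsilon$;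 it is uniformly continuous if for each $\varepsilon>0$ there is $\delta>0$ such that for any $x,c\in I$, $|x-c|<\delta$ implies $|f(x)-f(c)|<\varepsilon$. Given $a\le b$, a partition of $[a,b]$ is a finite subset of $[a,b]$ containing $a$ and $b$, written $a=x_0<x_1<\dots<x_n=b$. A function $\varphi:[a,b]\to\mathbb{R}$ is a step function if there is a partition $\{x_0,\dots,x_n\}$ of $[a,b]$ such that $\varphi$ is constant on $(x_{k-1},x_k)$ for each $k\in\{1,\dots,n\}$ (the values at the partition points do not matter). *)

theory Defs
  imports "HOL-Analysis.Analysis"
begin

text \<open>
  Over the type \<^typ>\<open>real\<close>, completeness is built in and every principle below is a theorem.
  Their equivalence as candidate completeness axioms is therefore stated over an arbitrary
  ordered field: each principle is a predicate on a type of class \<^class>\<open>linordered_field\<close>,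
  passed as an \<open>itself\<close> argument.  Such a type carries no topology or metric in the class
  hierarchy (library metrics are real-valued), so the topological notions are defined from the
  order and the absolute value, with \<open>\<epsilon>\<close> and \<open>\<delta>\<close> ranging over the field itself.

  Sequences are functions on \<^typ>\<open>nat\<close>, hence indexed from 0 instead of 1.  Functions on an
  interval are total functions of which only the values on the interval matter.
\<close>

subsection \<open>Sequences\<close>

definition fld_converges_to :: "(nat \<Rightarrow> 'a::linordered_field) \<Rightarrow> 'a \<Rightarrow> bool" where
  "fld_converges_to c l \<longleftrightarrow> (\<forall>\<epsilon>>0. \<exists>N. \<forall>n\<ge>N. \<bar>c n - l\<bar> < \<epsilon>)"

definition nested_intervals :: "(nat \<Rightarrow> 'a::linordered_field) \<Rightarrow> (nat \<Rightarrow> 'a) \<Rightarrow> bool" where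
  "nested_intervals a b \<longleftrightarrow>
     (\<forall>k. a k \<le> b k) \<and> (\<forall>k. {a (Suc k)..b (Suc k)} \<subseteq> {a k..b k})"

definition cofinal :: "'a::linordered_field set \<Rightarrow> bool" where
  "cofinal S \<longleftrightarrow> (\<forall>x. \<exists>N\<in>S. N > x)"

subsection \<open>Open sets and covers\<close>

definition fld_open :: "'a::linordered_field set \<Rightarrow> bool" where
  "fld_open G \<longleftrightarrow> (\<forall>x\<in>G. \<exists>u v. x \<in> {u<..<v} \<and> {u<..<v} \<subseteq> G)"

definition fld_open_cover :: "'a::linordered_field set set \<Rightarrow> 'a set \<Rightarrow> bool" where
  "fld_open_cover \<C> S \<longleftrightarrow> (\<forall>G\<in>\<C>. fld_open G) \<and> S \<subseteq> \<Union>\<C>"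

definition fld_compact :: "'a::linordered_field set \<Rightarrow> bool" where
  "fld_compact S \<longleftrightarrow>
     (\<forall>\<C>. fld_open_cover \<C> S \<longrightarrow> (\<exists>\<D>\<subseteq>\<C>. finite \<D> \<and> S \<subseteq> \<Union>\<D>))"

definition lebesgue_number :: "'a::linordered_field \<Rightarrow> 'a set set \<Rightarrow> 'a set \<Rightarrow> bool" where
  "lebesgue_number \<delta> \<C> S \<longleftrightarrow>
     \<delta> > 0 \<and> (\<forall>x\<in>S. \<forall>c\<in>S. \<bar>x - c\<bar> < \<delta> \<longrightarrow> (\<exists>G\<in>\<C>. x \<in> G \<and> c \<in> G))"

subsection \<open>Functions\<close>

definition fld_continuous_on :: "'a::linordered_field set \<Rightarrow> ('a \<Rightarrow> 'a) \<Rightarrow> bool" where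
  "fld_continuous_on I f \<longleftrightarrow>
     (\<forall>c\<in>I. \<forall>\<epsilon>>0. \<exists>\<delta>>0. \<forall>x\<in>I. \<bar>x - c\<bar> < \<delta> \<longrightarrow> \<bar>f x - f c\<bar> < \<epsilon>)"

definition fld_uniformly_continuous_on :: "'a::linordered_field set \<Rightarrow> ('a \<Rightarrow> 'a) \<Rightarrow> bool" where
  "fld_uniformly_continuous_on I f \<longleftrightarrow>
     (\<forall>\<epsilon>>0. \<exists>\<delta>>0. \<forall>x\<in>I. \<forall>c\<in>I. \<bar>x - c\<bar> < \<delta> \<longrightarrow> \<bar>f x - f c\<bar> < \<epsilon>)"

definition partition_of :: "'a::linordered_field set \<Rightarrow> 'a \<Rightarrow> 'a \<Rightarrow> bool" where
  "partition_of P a b \<longleftrightarrow> finite P \<and> P \<subseteq> {a..b} \<and> a \<in> P \<and> b \<in> P"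

text \<open>The list \<open>xs\<close> is the increasing enumeration \<open>x\<^sub>0 < \<dots> < x\<^sub>n\<close> of the partition, with
  \<open>n = length xs - 1\<close> (so \<open>n = 0\<close> if \<open>a = b\<close>).\<close>

definition step_function_on :: "'a::linordered_field \<Rightarrow> 'a \<Rightarrow> ('a \<Rightarrow> 'a) \<Rightarrow> bool" where
  "step_function_on a b \<phi> \<longleftrightarrow>
     (\<exists>P. partition_of P a b \<and>
        (let xs = sorted_list_of_set P in
           \<forall>k\<in>{1..<length xs}. \<phi> constant_on {xs ! (k - 1)<..<xs ! k}))"

subsection \<open>The principles\<close>

definition AP :: "'a::linordered_field itself \<Rightarrow> bool" where
  "AP T \<longleftrightarrow> (\<forall>x>(0::'a). \<forall>y>0. \<exists>N\<ge>1. of_nat N > x / y)"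

definition weak_NIP :: "'a::linordered_field itself \<Rightarrow> bool" where
  "weak_NIP T \<longleftrightarrow>
     (\<forall>a b :: nat \<Rightarrow> 'a. nested_intervals a b \<and> fld_converges_to (\<lambda>k. b k - a k) 0 \<longrightarrow>
        (\<Inter>k. {a k..b k}) \<noteq> {})"

definition LCL :: "'a::linordered_field itself \<Rightarrow> bool" where
  "LCL T \<longleftrightarrow>
     (\<forall>(a::'a) b \<C>. a \<le> b \<and> fld_open_cover \<C> {a..b} \<longrightarrow> (\<exists>\<delta>. lebesgue_number \<delta> \<C> {a..b}))"

definition UCT :: "'a::linordered_field itself \<Rightarrow> bool" where
  "UCT T \<longleftrightarrow>
     (\<forall>(a::'a) b f. a \<le> b \<and> fld_continuous_on {a..b} f \<longrightarrow> fld_uniformly_continuous_on {a..b} f)"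

definition UAS :: "'a::linordered_field itself \<Rightarrow> bool" where
  "UAS T \<longleftrightarrow>
     (\<forall>(a::'a) b f. a \<le> b \<and> fld_continuous_on {a..b} f \<longrightarrow>
        (\<forall>\<epsilon>>0. \<exists>\<phi>. step_function_on a b \<phi> \<and> (\<forall>x\<in>{a..b}. \<bar>f x - \<phi> x\<bar> < \<epsilon>)))"

definition CC :: "'a::linordered_field itself \<Rightarrow> bool" where
  "CC T \<longleftrightarrow> (\<exists>S::'a set. countable S \<and> infinite S \<and> cofinal S)"

definition BVT :: "'a::linordered_field itself \<Rightarrow> bool" where
  "BVT T \<longleftrightarrow>
     (\<forall>(a::'a) b f. a \<le> b \<and> fld_continuous_on {a..b} f \<longrightarrow>
        (\<exists>M. \<forall>x. a \<le> x \<and> x \<le> b \<longrightarrow> f x \<le> M))"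

definition MCP :: "'a::linordered_field itself \<Rightarrow> bool" where
  "MCP T \<longleftrightarrow>
     (\<forall>c :: nat \<Rightarrow> 'a. incseq c \<and> bdd_above (range c) \<longrightarrow> (\<exists>l. fld_converges_to c l))"

end

theory Submission
  imports Defs
begin

text \<open>
  The seven statements are linked in one cycle, (1) to (7) and back to (1).  Two ideas carry it.

  In a non-Archimedean field there is some \<open>e > 0\<close> all of whose multiples \<open>n * e\<close> stay below 1.
  Intervals of radius \<open>e\<close> then form a cover of \<open>[0,1]\<close> without a finite subcover, because finitely
  many of them cannot contain the infinitely many points \<open>2 * k * e\<close>
  (\<open>compact_unit_imp_AP\<close>).  The cut between the infinitesimals and
  the larger elements is a gap: the characteristic function of either side is continuous, although no
  step function comes close to it (\<open>UAS_imp_AP\<close>).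

  The only step that has to manufacture completeness out of a statement about functions is the one from
  the Bounded Value Theorem to monotone convergence (\<open>CC_BVT_imp_MCP\<close>).  A bounded increasing
  sequence without a limit has no least upper bound, so the field splits at a gap into the points
  below some term of the sequence and the upper bounds.  Both parts are open in the domain, so a
  function that is continuous on each part is continuous.  Below the gap take a piecewise linear
  function that outgrows, along the given sequence, every term of a countable cofinal sequence, and
  above the gap take 0.  The result is continuous and unbounded.

  The remaining steps follow the classical arguments: bisection yields compactness; a finite cover
  by intervals whose doubles still fit into members of the given cover yields a Lebesgue number;
  the cover by open sets of small oscillation turns a Lebesgue number into uniform continuity; a
  sufficiently fine uniform mesh, which the Archimedean principle makes finite, turns uniform
  continuity into a step function; and a step function takes finitely many values, hence is bounded.
  Monotone convergence forbids \<open>0, 1, 2, \<dots>\<close> to be bounded, since its steps do not shrink, and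
  the limit of the left endpoints of nested intervals lies in all of them.
\<close>

section \<open>The Archimedean principle\<close>

lemma AP_iff_of_nat_unbounded:
  "AP TYPE('a::linordered_field) \<longleftrightarrow> (\<forall>z::'a. \<exists>n. z < of_nat n)"
proof
  assume ap: "AP TYPE('a)"
  show "\<forall>z::'a. \<exists>n. z < of_nat n"
  proof
    fix z :: 'a
    have "max z 1 > 0" by (simp add: less_max_iff_disj)
    then obtain n where "max z 1 / 1 < of_nat n"
      using ap unfolding AP_def by (meson zero_less_one)
    then show "\<exists>n. z < of_nat n" by auto
  qed
next
  assume unb: "\<forall>z::'a. \<exists>n. z < of_nat n"
  show "AP TYPE('a)" unfolding AP_def
  proof (intro allI impI)
    fix x y :: 'a
    assume "0 < x" "0 < y"
    obtain n where n: "x / y < of_nat n" using unb by blast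
    moreover have "0 < x / y" using \<open>0 < x\<close> \<open>0 < y\<close> by simp
    ultimately have "n \<noteq> 0" by (cases n) auto
    with n show "\<exists>N\<ge>1. x / y < of_nat N" by (intro exI[of _ n]) auto
  qed
qed

text \<open>
  The witness is the reciprocal of an upper bound of the natural numbers.
\<close>

lemma not_AP_infinitesimal:
  assumes "\<not> AP TYPE('a::linordered_field)"
  obtains e :: "'a::linordered_field" where "e > 0" "\<And>n. of_nat n * e \<le> 1"
proof -
  obtain z :: 'a where z: "\<And>n. of_nat n \<le> z"
    using assms unfolding AP_iff_of_nat_unbounded by (auto simp: not_less)
  have "z > 0" using z[of 1] by (simp add: less_le_trans[OF zero_less_one])
  show thesis
  proof (rule that[of "1 / z"])
    show "1 / z > 0" using \<open>z > 0\<close> by simp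
    show "of_nat n * (1 / z) \<le> 1" for n using z[of n] \<open>z > 0\<close> by simp
  qed
qed

lemma AP_power2_tendsto_zero:
  assumes "AP TYPE('a::linordered_field)"
  shows "fld_converges_to (\<lambda>k. 1 / 2 ^ k :: 'a) 0"
  unfolding fld_converges_to_def
proof (intro allI impI)
  fix \<epsilon> :: 'a assume "\<epsilon> > 0"
  obtain N where N: "1 / \<epsilon> < of_nat N"
    using assms unfolding AP_iff_of_nat_unbounded by blast
  have "\<bar>1 / 2 ^ n - 0\<bar> < \<epsilon>" if "n \<ge> N" for n
  proof -
    have "1 / \<epsilon> < of_nat (2 ^ n)"
      using N that by (meson less_exp less_imp_le less_le_trans of_nat_le_iff order_trans)
    then have "1 / \<epsilon> < 2 ^ n" by simp
    then show ?thesis using \<open>\<epsilon> > 0\<close> by (simp add: field_simps)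
  qed
  then show "\<exists>N. \<forall>n\<ge>N. \<bar>1 / 2 ^ n - 0\<bar> < \<epsilon>" by blast
qed

section \<open>Open sets\<close>

lemma fld_open_ball: "fld_open {c - r<..<c + r :: 'a::linordered_field}"
  unfolding fld_open_def by blast

lemma fld_openE_ball:
  assumes "fld_open G" "(c::'a::linordered_field) \<in> G"
  obtains r where "r > 0" "{c - r<..<c + r} \<subseteq> G"
proof -
  obtain u v where uv: "u < c" "c < v" "{u<..<v} \<subseteq> G"
    using assms unfolding fld_open_def by force
  show thesis
  proof (rule that[of "min (c - u) (v - c)"])
    have "u \<le> c - min (c - u) (v - c)" "c + min (c - u) (v - c) \<le> v"
      by (auto simp: min_def)
    then show "{c - min (c - u) (v - c)<..<c + min (c - u) (v - c)} \<subseteq> G"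
      using uv(3) by force
  qed (use uv in auto)
qed

lemma fld_compactE:
  assumes "fld_compact S" "fld_open_cover \<C> S"
  obtains \<D> where "\<D> \<subseteq> \<C>" "finite \<D>" "S \<subseteq> \<Union>\<D>"
proof -
  have "\<exists>\<D>\<subseteq>\<C>. finite \<D> \<and> S \<subseteq> \<Union>\<D>"
    using assms unfolding fld_compact_def by (elim allE impE)
  then show thesis using that by blast
qed

section \<open>Compactness from nested intervals\<close>

definition finitely_covered :: "'a::linordered_field set set \<Rightarrow> 'a set \<Rightarrow> bool" where
  "finitely_covered \<C> S \<longleftrightarrow> (\<exists>\<D>\<subseteq>\<C>. finite \<D> \<and> S \<subseteq> \<Union>\<D>)"

lemma finitely_covered_Un:
  assumes "finitely_covered \<C> S" "finitely_covered \<C> T"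
  shows "finitely_covered \<C> (S \<union> T)"
proof -
  obtain D E where "D \<subseteq> \<C>" "finite D" "S \<subseteq> \<Union>D" "E \<subseteq> \<C>" "finite E" "T \<subseteq> \<Union>E"
    using assms unfolding finitely_covered_def by blast
  then show ?thesis unfolding finitely_covered_def by (intro exI[of _ "D \<union> E"]) auto
qed

text \<open>
  If both halves of an interval had finite subcovers, so would the interval.  Hence one can keep
  choosing a half that has none.
\<close>

lemma bisection_not_finitely_covered:
  assumes "\<not> finitely_covered \<C> {a..b :: 'a::linordered_field}" "a \<le> b"
  obtains A B where "A 0 = a" "B 0 = b" "nested_intervals A B"
    "\<And>k. B k - A k = (b - a) / 2 ^ k" "\<And>k. \<not> finitely_covered \<C> {A k..B k}"
proof -
  define good where "good k p \<longleftrightarrow> fst p \<le> snd p \<and> snd p - fst p = (b - a) / 2 ^ k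
      \<and> \<not> finitely_covered \<C> {fst p..snd p} \<and> (k = 0 \<longrightarrow> p = (a, b))" for k :: nat and p
  \<comment> \<open>The condition at \<open>k = 0\<close> pins the first interval, since dependent choice only promises that
    some good pair starts the sequence.\<close>
  have "\<exists>F. \<forall>k. good k (F k) \<and> {fst (F (Suc k))..snd (F (Suc k))} \<subseteq> {fst (F k)..snd (F k)}"
  proof (rule dependent_nat_choice)
    show "\<exists>p. good 0 p" using assms by (auto simp: good_def)
  next
    fix p k assume g: "good k p"
    define m where "m = (fst p + snd p) / 2"
    have m: "fst p \<le> m" "m \<le> snd p" "m - fst p = (b - a) / 2 ^ Suc k"
      "snd p - m = (b - a) / 2 ^ Suc k"
      using g unfolding m_def good_def by (auto simp: field_simps)
    have "{fst p..snd p} = {fst p..m} \<union> {m..snd p}" using m by auto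
    then have "\<not> finitely_covered \<C> {fst p..m} \<or> \<not> finitely_covered \<C> {m..snd p}"
      using g finitely_covered_Un unfolding good_def by metis
    then show "\<exists>q. good (Suc k) q \<and> {fst q..snd q} \<subseteq> {fst p..snd p}"
    proof
      assume "\<not> finitely_covered \<C> {fst p..m}"
      then show ?thesis using m by (intro exI[of _ "(fst p, m)"]) (auto simp: good_def)
    next
      assume "\<not> finitely_covered \<C> {m..snd p}"
      then show ?thesis using m by (intro exI[of _ "(m, snd p)"]) (auto simp: good_def)
    qed
  qed
  then obtain F where F: "\<And>k. good k (F k)"
    "\<And>k. {fst (F (Suc k))..snd (F (Suc k))} \<subseteq> {fst (F k)..snd (F k)}" by blast
  show thesis
  proof (rule that[of "fst \<circ> F" "snd \<circ> F"])
    show "nested_intervals (fst \<circ> F) (snd \<circ> F)"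
      using F unfolding nested_intervals_def good_def comp_def by blast
  qed (use F in \<open>auto simp: good_def\<close>)
qed

text \<open>
  The bisected intervals shrink to a common point.  A single member of the cover
  contains a neighbourhood of that point, hence a whole interval of the sequence, which was chosen
  to have no finite subcover.
\<close>

lemma AP_weak_NIP_imp_compact:
  assumes ap: "AP TYPE('a::linordered_field)" and nip: "weak_NIP TYPE('a)"
  shows "fld_compact {0..1::'a}"
  unfolding fld_compact_def finitely_covered_def[symmetric]
proof (intro allI impI, rule ccontr)
  fix \<C> :: "'a set set"
  assume cover: "fld_open_cover \<C> {0..1}" and "\<not> finitely_covered \<C> {0..1}"
  then obtain A B where AB: "A 0 = 0" "B 0 = 1" "nested_intervals A B"
    "\<And>k. B k - A k = (1 - 0) / 2 ^ k" "\<And>k. \<not> finitely_covered \<C> {A k..B k}"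
    using bisection_not_finitely_covered[of \<C> 0 1] by auto
  have lim: "fld_converges_to (\<lambda>k. B k - A k) 0"
    using AP_power2_tendsto_zero[OF ap] AB(4) by simp
  have "(\<Inter>k. {A k..B k}) \<noteq> {}"
    by (rule nip[unfolded weak_NIP_def, rule_format, OF conjI[OF AB(3) lim]])
  then obtain x where x: "\<And>k. x \<in> {A k..B k}" by blast
  have "x \<in> {0..1}" using x[of 0] AB by simp
  then obtain G where G: "G \<in> \<C>" "x \<in> G" "fld_open G"
    using cover unfolding fld_open_cover_def by blast
  then obtain r where r: "r > 0" "{x - r<..<x + r} \<subseteq> G" using fld_openE_ball by blast
  obtain k where "\<bar>B k - A k - 0\<bar> < r"
    using lim r(1) unfolding fld_converges_to_def by blast
  then have "{A k..B k} \<subseteq> {x - r<..<x + r}" using x[of k] by auto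
  then have "finitely_covered \<C> {A k..B k}"
    using r G unfolding finitely_covered_def by (intro exI[of _ "{G}"]) auto
  then show False using AB by blast
qed

section \<open>Consequences of compactness\<close>

text \<open>
  If \<open>e\<close> is infinitesimal, the points \<open>2 * k * e\<close> all lie in \<open>[0,1]\<close>, and an open interval of
  radius \<open>e\<close> contains at most one of them.  So no finite number of such intervals covers \<open>[0,1]\<close>.
\<close>

lemma compact_unit_imp_AP:
  assumes "fld_compact {0..1::'a::linordered_field}"
  shows "AP TYPE('a)"
proof (rule ccontr)
  assume "\<not> AP TYPE('a)"
  then obtain e :: 'a where e: "e > 0" "\<And>n. of_nat n * e \<le> 1"
    using not_AP_infinitesimal by blast
  have "c \<in> {c - e<..<c + e}" for c using e(1) by simp
  then have "fld_open_cover (range (\<lambda>c. {c - e<..<c + e})) {0..1}"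
    unfolding fld_open_cover_def using fld_open_ball by blast
  then obtain D where D: "D \<subseteq> range (\<lambda>c. {c - e<..<c + e})" "finite D" "{0..1} \<subseteq> \<Union>D"
    by (rule fld_compactE[OF assms])
  define p where "p k = of_nat (2 * k) * e" for k
  have "p k \<in> {0..1}" for k using e(2)[of "2 * k"] e(1) by (simp add: p_def)
  then have "\<forall>k. \<exists>G\<in>D. p k \<in> G" using D(3) by blast
  then obtain G where G: "\<And>k. G k \<in> D" "\<And>k. p k \<in> G k" by metis
  have "\<exists>i j. i < j \<and> G i = G j"
  proof -
    have "finite (range G)" using G(1) D(2) by (meson finite_subset image_subset_iff)
    then have "\<not> inj G" using finite_imageD by blast
    then show ?thesis unfolding inj_def by (metis linorder_neqE_nat)
  qed
  then obtain i j where ij: "i < j" "G i = G j" by blast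
  obtain c where c: "G i = {c - e<..<c + e}" using G(1)[of i] D(1) by blast
  have "c - e < p i" "p j < c + e" using G(2)[of i] G(2)[of j] ij(2) c by auto
  then have "p j - p i < 2 * e" by (simp add: algebra_simps)
  moreover have "p j - p i = 2 * e * of_nat (j - i)"
    using ij(1) by (simp add: p_def of_nat_diff algebra_simps)
  moreover have "2 * e * 1 \<le> 2 * e * of_nat (j - i)"
  proof (rule mult_left_mono)
    show "(1::'a) \<le> of_nat (j - i)" using ij(1) by (metis One_nat_def Suc_leI of_nat_1 of_nat_le_iff zero_less_diff)
  qed (use e(1) in simp)
  ultimately show False by simp
qed

text \<open>
  The affine map from \<open>[0,1]\<close> onto \<open>[a,b]\<close> pulls open covers back to open covers.
\<close>

lemma compact_unit_imp_compact_interval: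
  assumes cpt: "fld_compact {0..1::'a::linordered_field}"
  shows "fld_compact {a..b::'a}"
proof (cases "a < b")
  case True
  define h where "h t = a + (b - a) * t" for t
  define g where "g x = (x - a) / (b - a)" for x
  have hg: "h (g x) = x" for x using True by (simp add: h_def g_def)
  show ?thesis unfolding fld_compact_def
  proof (intro allI impI)
    fix \<C> assume cover: "fld_open_cover \<C> {a..b}"
    have op: "fld_open (h -` G)" if G: "fld_open G" for G
      unfolding fld_open_def
    proof
      fix t assume "t \<in> h -` G"
      then obtain r where r: "r > 0" "{h t - r<..<h t + r} \<subseteq> G"
        using fld_openE_ball[OF G, of "h t"] by auto
      have "{t - r / (b - a)<..<t + r / (b - a)} \<subseteq> h -` G"
      proof
        fix s assume s: "s \<in> {t - r / (b - a)<..<t + r / (b - a)}"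
        then have "(b - a) * (t - r / (b - a)) < (b - a) * s"
          "(b - a) * s < (b - a) * (t + r / (b - a))"
          using True by (simp_all add: mult_less_cancel_left_pos del: times_divide_eq_right)
        then have "h s \<in> {h t - r<..<h t + r}"
          using True by (auto simp: h_def distrib_left right_diff_distrib)
        then show "s \<in> h -` G" using r by blast
      qed
      then show "\<exists>u v. t \<in> {u<..<v} \<and> {u<..<v} \<subseteq> h -` G"
        using r(1) True by (intro exI[of _ "t - r / (b - a)"] exI[of _ "t + r / (b - a)"]) auto
    qed
    have hrange: "h t \<in> {a..b}" if "t \<in> {0..1}" for t
    proof -
      have "(b - a) * t \<le> (b - a) * 1" "0 \<le> (b - a) * t"
        using that True by (intro mult_left_mono mult_nonneg_nonneg; simp)+
      then show ?thesis by (simp add: h_def)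
    qed
    have "fld_open_cover ((\<lambda>G. h -` G) ` \<C>) {0..1}"
      using cover op hrange unfolding fld_open_cover_def by fastforce
    then obtain D where "D \<subseteq> (\<lambda>G. h -` G) ` \<C>" "finite D" "{0..1} \<subseteq> \<Union>D"
      by (rule fld_compactE[OF cpt])
    then obtain E where E: "E \<subseteq> \<C>" "finite E" "{0..1} \<subseteq> (\<Union>G\<in>E. h -` G)"
      by (metis finite_subset_image)
    have "{a..b} \<subseteq> \<Union>E"
    proof
      fix x assume "x \<in> {a..b}"
      then have "g x \<in> {0..1}" using True by (simp add: g_def)
      then show "x \<in> \<Union>E" using subsetD[OF E(3)] hg[of x] by fastforce
    qed
    with E show "\<exists>\<D>\<subseteq>\<C>. finite \<D> \<and> {a..b} \<subseteq> \<Union>\<D>" by blast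
  qed
next
  case False
  then have "{a..b} \<subseteq> {a}" by auto
  show ?thesis unfolding fld_compact_def
  proof (intro allI impI)
    fix \<C> assume "fld_open_cover \<C> {a..b}"
    then have cov: "{a..b} \<subseteq> \<Union>\<C>" by (simp add: fld_open_cover_def)
    show "\<exists>\<D>\<subseteq>\<C>. finite \<D> \<and> {a..b} \<subseteq> \<Union>\<D>"
    proof (cases "{a..b} = {}")
      case True then show ?thesis by (intro exI[of _ "{}"]) auto
    next
      case ne: False
      then have "a \<in> {a..b}" using \<open>{a..b} \<subseteq> {a}\<close> by blast
      then obtain G where "G \<in> \<C>" "a \<in> G" using cov by blast
      then show ?thesis using \<open>{a..b} \<subseteq> {a}\<close> by (intro exI[of _ "{G}"]) auto
    qed
  qed
qed

text \<open>
  Around each point \<open>c\<close> take a radius \<open>r c\<close> such that the interval of twice that radius lies in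
  one member of the cover.  If the intervals of radius \<open>r c\<close> with \<open>c\<close> in a finite set \<open>F\<close> cover
  \<open>S\<close>, a point closer than all these \<open>r c\<close> to a point of such an interval is still in the doubled
  one.
\<close>

lemma compact_imp_lebesgue_number:
  assumes cpt: "fld_compact (S::'a::linordered_field set)" and cover: "fld_open_cover \<C> S"
  shows "\<exists>\<delta>. lebesgue_number \<delta> \<C> S"
proof -
  have "\<exists>r>0. \<exists>G\<in>\<C>. {c - 2 * r<..<c + 2 * r} \<subseteq> G" if c: "c \<in> S" for c
  proof -
    obtain G where G: "G \<in> \<C>" "c \<in> G" "fld_open G"
      using cover c unfolding fld_open_cover_def by blast
    then obtain r where "r > 0" "{c - r<..<c + r} \<subseteq> G" using fld_openE_ball by blast
    then show ?thesis using G(1) by (intro exI[of _ "r / 2"]) auto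
  qed
  then obtain r where r: "\<And>c. c \<in> S \<Longrightarrow> r c > 0"
    "\<And>c. c \<in> S \<Longrightarrow> \<exists>G\<in>\<C>. {c - 2 * r c<..<c + 2 * r c} \<subseteq> G" by metis
  have "c \<in> {c - r c<..<c + r c}" if "c \<in> S" for c using r(1)[OF that] by simp
  then have "fld_open_cover ((\<lambda>c. {c - r c<..<c + r c}) ` S) S"
    unfolding fld_open_cover_def using fld_open_ball by blast
  then obtain D where D: "D \<subseteq> (\<lambda>c. {c - r c<..<c + r c}) ` S" "finite D" "S \<subseteq> \<Union>D"
    by (rule fld_compactE[OF cpt])
  obtain F where "F \<subseteq> S" "finite F" "D = (\<lambda>c. {c - r c<..<c + r c}) ` F"
    using finite_subset_image[OF D(2,1)] by blast
  then have F: "F \<subseteq> S" "finite F" "S \<subseteq> (\<Union>c\<in>F. {c - r c<..<c + r c})"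
    using D(3) by simp_all
  \<comment> \<open>The element 1 keeps the minimum meaningful when \<open>F\<close> is empty.\<close>
  define \<delta> where "\<delta> = Min (insert 1 (r ` F))"
  have "\<delta> > 0" using F r(1) by (auto simp: \<delta>_def)
  have \<delta>_le: "\<delta> \<le> r c" if "c \<in> F" for c using that F(2) by (simp add: \<delta>_def)
  have "\<exists>G\<in>\<C>. x \<in> G \<and> y \<in> G" if xy: "x \<in> S" "\<bar>x - y\<bar> < \<delta>" for x y
  proof -
    obtain c where c: "c \<in> F" "c - r c < x" "x < c + r c" using F(3) xy(1) by auto
    have "\<bar>x - y\<bar> < r c" using xy(2) \<delta>_le[OF c(1)] by simp
    then have "x \<in> {c - 2 * r c<..<c + 2 * r c}" "y \<in> {c - 2 * r c<..<c + 2 * r c}"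
      using c(2,3) by (auto simp: abs_less_iff algebra_simps)
    moreover obtain G where "G \<in> \<C>" "{c - 2 * r c<..<c + 2 * r c} \<subseteq> G"
      using r(2) c(1) F(1) by (meson subsetD)
    ultimately show ?thesis by blast
  qed
  then show ?thesis using \<open>\<delta> > 0\<close> unfolding lebesgue_number_def by blast
qed

section \<open>Uniform continuity\<close>

text \<open>
  Continuity says that the open sets on which \<open>f\<close> oscillates by less than \<open>\<epsilon>\<close> cover \<open>[a,b]\<close>, and a
  Lebesgue number of this cover is a modulus of uniform continuity for \<open>\<epsilon>\<close>.
\<close>

lemma LCL_imp_UCT:
  assumes lcl: "LCL TYPE('a::linordered_field)"
  shows "UCT TYPE('a)"
  unfolding UCT_def fld_uniformly_continuous_on_def
proof (intro allI impI)
  fix a b \<epsilon> :: 'a and f :: "'a \<Rightarrow> 'a"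
  assume H: "a \<le> b \<and> fld_continuous_on {a..b} f" and "\<epsilon> > 0"
  define \<C> where
    "\<C> = {G. fld_open G \<and> (\<forall>x\<in>G \<inter> {a..b}. \<forall>c\<in>G \<inter> {a..b}. \<bar>f x - f c\<bar> < \<epsilon>)}"
  have "\<exists>G\<in>\<C>. c \<in> G" if c: "c \<in> {a..b}" for c
  proof -
    obtain d where d: "d > 0" "\<And>x. x \<in> {a..b} \<Longrightarrow> \<bar>x - c\<bar> < d \<Longrightarrow> \<bar>f x - f c\<bar> < \<epsilon> / 2"
      using H c \<open>\<epsilon> > 0\<close> unfolding fld_continuous_on_def by (meson half_gt_zero)
    have near: "\<bar>f x - f c\<bar> < \<epsilon> / 2" if "x \<in> {c - d<..<c + d} \<inter> {a..b}" for x
      using d(2)[of x] that by (auto simp: abs_less_iff)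
    have "\<bar>f x - f y\<bar> < \<epsilon>"
      if "x \<in> {c - d<..<c + d} \<inter> {a..b}" "y \<in> {c - d<..<c + d} \<inter> {a..b}" for x y
      using near[OF that(1)] near[OF that(2)] by (auto simp: abs_if split: if_splits)
    then have "{c - d<..<c + d} \<in> \<C>" unfolding \<C>_def by (auto simp: fld_open_ball)
    moreover have "c \<in> {c - d<..<c + d}" using d(1) by simp
    ultimately show ?thesis by blast
  qed
  then have "fld_open_cover \<C> {a..b}" unfolding fld_open_cover_def by (auto simp: \<C>_def)
  then obtain \<delta> where \<delta>: "lebesgue_number \<delta> \<C> {a..b}"
    using lcl[unfolded LCL_def, rule_format, OF conjI] H by blast
  then have "\<bar>f x - f c\<bar> < \<epsilon>" if "x \<in> {a..b}" "c \<in> {a..b}" "\<bar>x - c\<bar> < \<delta>" for x c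
    using that unfolding lebesgue_number_def \<C>_def by blast
  then show "\<exists>\<delta>>0. \<forall>x\<in>{a..b}. \<forall>c\<in>{a..b}. \<bar>x - c\<bar> < \<delta> \<longrightarrow> \<bar>f x - f c\<bar> < \<epsilon>"
    using \<delta> unfolding lebesgue_number_def by blast
qed

section \<open>Step functions\<close>

text \<open>
  Two entries of the increasing enumeration are neighbours exactly if no partition point
  lies between them.  This replaces indices by an order condition on the partition, for which
  neighbours can be produced as a maximum and a minimum.
\<close>

lemma step_function_on_iff_gaps:
  "step_function_on a b \<phi> \<longleftrightarrow> (\<exists>P. partition_of P a b \<and>
     (\<forall>u\<in>P. \<forall>v\<in>P. u < v \<and> P \<inter> {u<..<v} = {} \<longrightarrow> \<phi> constant_on {u<..<v}))"
proof -
  have "(\<forall>k\<in>{1..<length (sorted_list_of_set P)}.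
           \<phi> constant_on {sorted_list_of_set P ! (k - 1)<..<sorted_list_of_set P ! k})
      \<longleftrightarrow> (\<forall>u\<in>P. \<forall>v\<in>P. u < v \<and> P \<inter> {u<..<v} = {} \<longrightarrow> \<phi> constant_on {u<..<v})"
    (is "?L = ?R") if part: "partition_of P a b" for P
  proof -
    define xs where "xs = sorted_list_of_set P"
    have fin: "finite P" using part by (simp add: partition_of_def)
    have set: "set xs = P" using fin by (simp add: xs_def)
    have mono: "xs ! i < xs ! j" if "i < j" "j < length xs" for i j
      using that by (simp add: xs_def sorted_wrt_nth_less strict_sorted_list_of_set)
    have mono_iff: "xs ! i < xs ! j \<longleftrightarrow> i < j" if "i < length xs" "j < length xs" for i j
      using that mono by (metis less_irrefl less_trans linorder_neqE_nat)
    show ?thesis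
    proof
      assume L: ?L
      show ?R
      proof (intro ballI impI)
        fix u v assume uv: "u \<in> P" "v \<in> P" "u < v \<and> P \<inter> {u<..<v} = {}"
        obtain i j where ij: "i < length xs" "xs ! i = u" "j < length xs" "xs ! j = v"
          using uv set by (metis in_set_conv_nth)
        have "i < j" using mono_iff ij uv by blast
        have "j = Suc i"
        proof (rule ccontr)
          assume "j \<noteq> Suc i"
          then have "Suc i < j" using \<open>i < j\<close> by simp
          then have "xs ! Suc i \<in> P \<inter> {u<..<v}"
            using mono[of i "Suc i"] mono[of "Suc i" j] ij set by force
          then show False using uv by blast
        qed
        then show "\<phi> constant_on {u<..<v}" using L[folded xs_def] ij by force
      qed
    next
      assume R: ?R
      have "\<phi> constant_on {xs ! (k - 1)<..<xs ! k}" if k: "k \<in> {1..<length xs}" for k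
      proof -
        have "P \<inter> {xs ! (k - 1)<..<xs ! k} = {}"
        proof (rule ccontr)
          assume "P \<inter> {xs ! (k - 1)<..<xs ! k} \<noteq> {}"
          then obtain i where "i < length xs" "xs ! (k - 1) < xs ! i" "xs ! i < xs ! k"
            using set by (metis Int_iff all_not_in_conv greaterThanLessThan_iff in_set_conv_nth)
          then have "k - 1 < i" "i < k" using mono_iff k by auto
          then show False by simp
        qed
        moreover have "xs ! (k - 1) \<in> P" "xs ! k \<in> P" using k set by auto
        moreover have "xs ! (k - 1) < xs ! k" using k by (intro mono) auto
        ultimately show ?thesis using R by blast
      qed
      then show ?L unfolding xs_def by blast
    qed
  qed
  then show ?thesis unfolding step_function_on_def Let_def by blast
qed

lemma step_function_finite_range:
  assumes "step_function_on a b \<phi>"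
  shows "finite (\<phi> ` {a..b})"
proof -
  obtain P where P: "partition_of P a b"
    "\<And>u v. u \<in> P \<Longrightarrow> v \<in> P \<Longrightarrow> u < v \<Longrightarrow> P \<inter> {u<..<v} = {} \<Longrightarrow> \<phi> constant_on {u<..<v}"
    using assms unfolding step_function_on_iff_gaps by blast
  have fin: "finite P" "a \<in> P" "b \<in> P" using P(1) by (auto simp: partition_of_def)
  define Q where "Q = {(u, v) \<in> P \<times> P. u < v \<and> P \<inter> {u<..<v} = {}}"
  have "finite Q" using fin(1) by (auto simp: Q_def intro: finite_subset[of _ "P \<times> P"])
  have "finite (\<phi> ` {u<..<v})" if "(u, v) \<in> Q" for u v
  proof -
    have "\<phi> constant_on {u<..<v}" using that P(2) by (auto simp: Q_def)
    then obtain y where "\<phi> ` {u<..<v} \<subseteq> {y}" unfolding constant_on_def by blast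
    then show ?thesis using finite_subset by blast
  qed
  then have "finite (\<phi> ` P \<union> (\<Union>(u, v)\<in>Q. \<phi> ` {u<..<v}))"
    using \<open>finite Q\<close> fin(1) by auto
  moreover have "\<phi> ` {a..b} \<subseteq> \<phi> ` P \<union> (\<Union>(u, v)\<in>Q. \<phi> ` {u<..<v})"
  proof
    fix y assume "y \<in> \<phi> ` {a..b}"
    then obtain x where x: "x \<in> {a..b}" "y = \<phi> x" by blast
    show "y \<in> \<phi> ` P \<union> (\<Union>(u, v)\<in>Q. \<phi> ` {u<..<v})"
    proof (cases "x \<in> P")
      case False
      then have ab: "a < x" "x < b" using x fin by (auto simp: less_le)
      define u where "u = Max {p \<in> P. p < x}"
      define v where "v = Min {p \<in> P. x < p}"
      have "u \<in> {p \<in> P. p < x}" unfolding u_def using fin ab by (intro Max_in) auto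
      moreover have "v \<in> {p \<in> P. x < p}" unfolding v_def using fin ab by (intro Min_in) auto
      moreover have "p \<le> u" if "p \<in> P" "p < x" for p
        unfolding u_def using fin that by (intro Max_ge) auto
      moreover have "v \<le> p" if "p \<in> P" "x < p" for p
        unfolding v_def using fin that by (intro Min_le) auto
      ultimately have "(u, v) \<in> Q" "x \<in> {u<..<v}"
        using False by (force simp: Q_def dest: linorder_neqE)+
      then show ?thesis using x(2) by blast
    qed (use x in blast)
  qed
  ultimately show ?thesis using finite_subset by blast
qed

text \<open>
  AP provides a uniform mesh finer than the modulus of uniform continuity.  The approximation is
  \<open>f \<circ> l\<close>, where \<open>l\<close> rounds each point down to the mesh.
\<close>

lemma AP_UCT_imp_UAS:
  assumes ap: "AP TYPE('a::linordered_field)" and uct: "UCT TYPE('a)"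
  shows "UAS TYPE('a)"
  unfolding UAS_def
proof (intro allI impI)
  fix a b \<epsilon> :: 'a and f :: "'a \<Rightarrow> 'a"
  assume H: "a \<le> b \<and> fld_continuous_on {a..b} f" and "\<epsilon> > 0"
  then obtain \<delta> where \<delta>: "\<delta> > 0"
    "\<And>x c. x \<in> {a..b} \<Longrightarrow> c \<in> {a..b} \<Longrightarrow> \<bar>x - c\<bar> < \<delta> \<Longrightarrow> \<bar>f x - f c\<bar> < \<epsilon>"
    using uct unfolding UCT_def fld_uniformly_continuous_on_def by meson
  obtain N where N: "(b - a) / \<delta> < of_nat N"
    using ap unfolding AP_iff_of_nat_unbounded by blast
  then have "N > 0" using H \<delta>(1)
    by (metis diff_ge_0_iff_ge divide_nonneg_pos less_le_not_le of_nat_0 gr0I)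
  define h where "h = (b - a) / of_nat N"
  have h: "0 \<le> h" "h < \<delta>" "a + of_nat N * h = b"
    using N \<open>N > 0\<close> H \<delta>(1) by (auto simp: h_def field_simps)
  define P where "P = (\<lambda>k. a + of_nat k * h) ` {..N}"
  have "finite P" "a \<in> P" "b \<in> P" unfolding P_def using h(3) by force+
  have "P \<subseteq> {a..b}"
  proof
    fix p assume "p \<in> P"
    then obtain k where k: "k \<le> N" "p = a + of_nat k * h" by (auto simp: P_def)
    have "of_nat k * h \<le> of_nat N * h" using k(1) h(1) by (intro mult_right_mono) auto
    then show "p \<in> {a..b}" using k(2) h by auto
  qed
  define l where "l x = Max {p \<in> P. p \<le> x}" for x
  have l_in: "l x \<in> P" "l x \<le> x" and l_ge: "\<And>p. p \<in> P \<Longrightarrow> p \<le> x \<Longrightarrow> p \<le> l x"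
    if "a \<le> x" for x
  proof -
    have "l x \<in> {p \<in> P. p \<le> x}"
      unfolding l_def using \<open>finite P\<close> \<open>a \<in> P\<close> that by (intro Max_in) auto
    then show "l x \<in> P" "l x \<le> x" by auto
    show "p \<le> l x" if "p \<in> P" "p \<le> x" for p
      unfolding l_def using \<open>finite P\<close> that by (intro Max_ge) auto
  qed
  have "step_function_on a b (f \<circ> l)"
    unfolding step_function_on_iff_gaps
  proof (intro exI[of _ P] conjI ballI impI)
    show "partition_of P a b"
      using \<open>finite P\<close> \<open>a \<in> P\<close> \<open>b \<in> P\<close> \<open>P \<subseteq> {a..b}\<close> by (simp add: partition_of_def)
  next
    fix u v assume uv: "u \<in> P" "v \<in> P" "u < v \<and> P \<inter> {u<..<v} = {}"
    have "l x = u" if "x \<in> {u<..<v}" for x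
    proof (rule antisym)
      have "a \<le> x" using that uv(1) \<open>P \<subseteq> {a..b}\<close> by force
      then have "l x \<in> P" "l x \<le> x" "u \<le> l x" using l_in l_ge[of x u] uv(1) that by auto
      then show "u \<le> l x" "l x \<le> u" using uv(3) that by (auto simp: disjoint_iff not_less[symmetric])
    qed
    then show "(f \<circ> l) constant_on {u<..<v}" unfolding constant_on_def by auto
  qed
  moreover have "\<bar>f x - (f \<circ> l) x\<bar> < \<epsilon>" if x: "x \<in> {a..b}" for x
  proof -
    obtain k where k: "k \<le> N" "l x = a + of_nat k * h"
      using l_in[of x] x by (auto simp: P_def)
    \<comment> \<open>Otherwise the next mesh point \<open>l x + h\<close> would not exceed \<open>x\<close> either.  The degenerate
      mesh \<open>h = 0\<close> arises for \<open>a = b\<close>.\<close>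
    have "x - l x < \<delta>"
    proof (cases "k = N")
      case True
      then show ?thesis using k h x l_in[of x] \<delta>(1) by auto
    next
      case False
      then have "l x + h \<in> P" unfolding P_def using k
        by (intro image_eqI[of _ _ "Suc k"]) (auto simp: algebra_simps)
      moreover have "x < l x + h" if "0 < h"
        using l_ge[of x "l x + h"] calculation x that by (auto simp: not_le[symmetric])
      moreover have "x = l x" if "h = 0"
        using that h(3) x k(2) by auto
      ultimately show ?thesis using h \<delta>(1) by (cases "h = 0") (auto simp: algebra_simps)
    qed
    then have "\<bar>x - l x\<bar> < \<delta>" using l_in[of x] x by auto
    then show ?thesis using \<delta>(2)[OF x] l_in[of x] \<open>P \<subseteq> {a..b}\<close> x by auto
  qed
  ultimately show "\<exists>\<phi>. step_function_on a b \<phi> \<and> (\<forall>x\<in>{a..b}. \<bar>f x - \<phi> x\<bar> < \<epsilon>)" by blast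
qed

lemma UAS_imp_BVT:
  assumes uas: "UAS TYPE('a::linordered_field)"
  shows "BVT TYPE('a)"
  unfolding BVT_def
proof (intro allI impI)
  fix a b :: 'a and f :: "'a \<Rightarrow> 'a"
  assume cont: "a \<le> b \<and> fld_continuous_on {a..b} f"
  obtain \<phi> where \<phi>: "step_function_on a b \<phi>" "\<And>x. x \<in> {a..b} \<Longrightarrow> \<bar>f x - \<phi> x\<bar> < 1"
    using uas[unfolded UAS_def, rule_format, OF cont zero_less_one] by blast
  have "f x \<le> Max (\<phi> ` {a..b}) + 1" if "x \<in> {a..b}" for x
  proof -
    have "\<phi> x \<le> Max (\<phi> ` {a..b})"
      using step_function_finite_range[OF \<phi>(1)] that by (intro Max_ge) auto
    then show ?thesis using \<phi>(2)[OF that] by (simp add: abs_less_iff algebra_simps)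
  qed
  then show "\<exists>M. \<forall>x. a \<le> x \<and> x \<le> b \<longrightarrow> f x \<le> M" by auto
qed

text \<open>
  In a non-Archimedean field, let \<open>f\<close> be 0 on the elements that are at most infinitesimal and 1 on
  the others.  It is continuous, since moving by an infinitesimal \<open>e\<close> does not change the
  side.  In any partition of \<open>[0,1]\<close> there are neighbours \<open>u < v\<close> on different sides, and then \<open>u + e\<close> and
  \<open>v - e\<close> lie strictly between them and still on different sides.  So a step function that is constant
  on \<open>(u,v)\<close> cannot be within 1/2 of both values of \<open>f\<close>.
\<close>

lemma UAS_imp_AP:
  assumes uas: "UAS TYPE('a::linordered_field)"
  shows "AP TYPE('a)"
proof (rule ccontr)
  assume "\<not> AP TYPE('a)"
  define infi where "infi x \<longleftrightarrow> (\<forall>n. of_nat n * x \<le> 1)" for x :: 'a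
  obtain e where e: "e > 0" "infi e"
    using not_AP_infinitesimal[OF \<open>\<not> AP TYPE('a)\<close>] unfolding infi_def by blast
  have down: "infi x" if "infi y" "x \<le> y" for x y
    using that unfolding infi_def by (meson mult_left_mono of_nat_0_le_iff order_trans)
  have add: "infi (x + y)" if "infi x" "infi y" for x y
    unfolding infi_def
  proof
    fix n
    have "of_nat (2 * n) * x \<le> 1" "of_nat (2 * n) * y \<le> 1" using that unfolding infi_def by blast+
    then show "of_nat n * (x + y) \<le> 1" by (simp add: algebra_simps)
  qed
  have shift: "infi (x + e) \<longleftrightarrow> infi x" for x
    using add[of x e] down[of "x + e" x] e by auto
  define f :: "'a \<Rightarrow> 'a" where "f x = (if infi x then 0 else 1)" for x
  have "fld_continuous_on {0..1} f"
    unfolding fld_continuous_on_def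
  proof (intro ballI allI impI)
    fix c \<epsilon> :: 'a assume "\<epsilon> > 0"
    have const: "f x = f c" if "\<bar>x - c\<bar> < e" for x
    proof -
      have "x \<le> c + e" "c \<le> x + e" using that by (auto simp: abs_less_iff algebra_simps)
      then have "infi x \<longleftrightarrow> infi c" using down shift by blast
      then show ?thesis by (simp add: f_def)
    qed
    then show "\<exists>\<delta>>0. \<forall>x\<in>{0..1}. \<bar>x - c\<bar> < \<delta> \<longrightarrow> \<bar>f x - f c\<bar> < \<epsilon>"
    proof (intro exI conjI ballI impI)
      fix x assume "\<bar>x - c\<bar> < e"
      from const[OF this] show "\<bar>f x - f c\<bar> < \<epsilon>" using \<open>\<epsilon> > 0\<close> by simp
    qed (rule e(1))
  qed
  then have "\<exists>\<phi>. step_function_on 0 1 \<phi> \<and> (\<forall>x\<in>{0..1}. \<bar>f x - \<phi> x\<bar> < 1 / 2)"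
    by (intro uas[unfolded UAS_def, rule_format]) auto
  then obtain \<phi> where \<phi>: "step_function_on 0 1 \<phi>"
    "\<And>x. x \<in> {0..1} \<Longrightarrow> \<bar>f x - \<phi> x\<bar> < 1 / 2" by blast
  obtain P where P: "partition_of P 0 1"
    "\<And>u v. u \<in> P \<Longrightarrow> v \<in> P \<Longrightarrow> u < v \<Longrightarrow> P \<inter> {u<..<v} = {} \<Longrightarrow> \<phi> constant_on {u<..<v}"
    using \<phi>(1) unfolding step_function_on_iff_gaps by blast
  have fin: "finite P" "0 \<in> P" "1 \<in> P" "P \<subseteq> {0..1}" using P(1) by (auto simp: partition_of_def)
  have "infi 0" by (simp add: infi_def)
  have "\<not> infi 1"
  proof
    assume "infi 1"
    then have "of_nat 2 * (1::'a) \<le> 1" unfolding infi_def by blast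
    then show False by simp
  qed
  define u where "u = Max {p \<in> P. infi p}"
  define v where "v = Min {p \<in> P. \<not> infi p}"
  have "u \<in> {p \<in> P. infi p}" unfolding u_def using fin \<open>infi 0\<close> by (intro Max_in) auto
  moreover have "v \<in> {p \<in> P. \<not> infi p}" unfolding v_def using fin \<open>\<not> infi 1\<close> by (intro Min_in) auto
  moreover have "p \<le> u" if "p \<in> P" "infi p" for p
    unfolding u_def using fin that by (intro Max_ge) auto
  moreover have "v \<le> p" if "p \<in> P" "\<not> infi p" for p
    unfolding v_def using fin that by (intro Min_le) auto
  ultimately have u: "u \<in> P" "infi u" and v: "v \<in> P" "\<not> infi v"
    and gap: "P \<inter> {u<..<v} = {}" by (auto simp: disjoint_iff) force
  have "u + e < v" using down[of "u + e" v] shift[of u] u v by (auto simp: not_le[symmetric])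
  then have "u < v" using e(1) by (simp add: add_strict_increasing2 less_trans[of u "u + e"])
  obtain y where y: "\<And>x. x \<in> {u<..<v} \<Longrightarrow> \<phi> x = y"
    using P(2)[OF u(1) v(1) \<open>u < v\<close> gap] unfolding constant_on_def by blast
  have in1: "u + e \<in> {u<..<v}" "v - e \<in> {u<..<v}"
    using \<open>u + e < v\<close> e(1) by (auto simp: algebra_simps)
  have "{u<..<v} \<subseteq> {0..1}" using u(1) v(1) fin(4) by force
  then have "\<bar>f (u + e) - y\<bar> < 1 / 2" "\<bar>f (v - e) - y\<bar> < 1 / 2"
    using \<phi>(2) y in1 by (metis subsetD)+
  moreover have "f (u + e) = 0" "f (v - e) = 1"
    using shift[of u] shift[of "v - e"] u v by (auto simp: f_def)
  ultimately show False by (auto simp: abs_if split: if_splits)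
qed

lemma AP_imp_CC:
  assumes "AP TYPE('a::linordered_field)"
  shows "CC TYPE('a)"
  unfolding CC_def
proof (intro exI conjI)
  show "countable (range (of_nat :: nat \<Rightarrow> 'a))" by simp
  show "infinite (range (of_nat :: nat \<Rightarrow> 'a))"
    by (simp add: range_inj_infinite inj_of_nat)
  show "cofinal (range (of_nat :: nat \<Rightarrow> 'a))"
    using assms unfolding AP_iff_of_nat_unbounded cofinal_def by blast
qed

section \<open>Monotone convergence\<close>

text \<open>
  Partial sums of absolute values turn an arbitrary enumeration of a cofinal set into an increasing
  nonnegative sequence that dominates it.
\<close>

lemma CC_cofinal_sequence:
  assumes "CC TYPE('a::linordered_field)"
  obtains d :: "nat \<Rightarrow> 'a::linordered_field" where "incseq d" "\<And>n. 0 \<le> d n" "\<And>x. \<exists>n. x < d n"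
proof -
  obtain S :: "'a set" where S: "countable S" "infinite S" "cofinal S"
    using assms unfolding CC_def by blast
  define s where "s = from_nat_into S"
  have s: "range s = S" using S by (simp add: s_def range_from_nat_into infinite_imp_nonempty)
  define d where "d n = (\<Sum>i\<le>n. \<bar>s i\<bar>)" for n
  have "s n \<le> d n" for n
  proof -
    have "s n \<le> \<bar>s n\<bar>" by (rule abs_ge_self)
    also have "\<dots> \<le> d n" unfolding d_def by (rule member_le_sum) auto
    finally show ?thesis .
  qed
  then have unb: "\<exists>n. x < d n" for x
    using S(3) s unfolding cofinal_def by (metis imageE less_le_trans)
  show thesis
    by (rule that[OF _ _ unb]) (auto simp: d_def incseq_Suc_iff intro: sum_nonneg)
qed

lemma not_convergent_no_least_upper_bound:
  fixes c :: "nat \<Rightarrow> 'a::linordered_field"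
  assumes inc: "incseq c" and nc: "\<nexists>l. fld_converges_to c l" and ub: "\<And>n. c n \<le> x"
  obtains y where "y < x" "\<And>n. c n \<le> y"
proof -
  have "\<exists>\<epsilon>>0. \<forall>N. \<exists>n\<ge>N. \<epsilon> \<le> \<bar>c n - x\<bar>"
    using nc unfolding fld_converges_to_def by (metis not_le)
  then obtain \<epsilon> where \<epsilon>: "\<epsilon> > 0" "\<And>N. \<exists>n\<ge>N. \<epsilon> \<le> \<bar>c n - x\<bar>" by blast
  have "c N \<le> x - \<epsilon>" for N
  proof -
    obtain n where n: "n \<ge> N" "\<epsilon> \<le> \<bar>c n - x\<bar>" using \<epsilon>(2) by blast
    have "c N \<le> c n" using inc n(1) by (simp add: incseq_def)
    also have "c n \<le> x - \<epsilon>" using n(2) ub[of n] by (simp add: abs_if algebra_simps split: if_splits)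
    finally show ?thesis .
  qed
  then show thesis using \<epsilon>(1) by (intro that[of "x - \<epsilon>"]) auto
qed

text \<open>
  Let \<open>c\<close> be increasing and bounded without a limit, and let \<open>d\<close> be increasing and cofinal.  The
  function \<open>f\<close> is the piecewise linear function \<open>\<Sum>n. s n * max 0 (x - c n)\<close> below the gap, where only finitely
  many summands are nonzero, and 0 above it.  Its slope increases at \<open>c n\<close> by \<open>s n\<close>, chosen so
  that the \<open>n\<close>-th summand alone has grown to \<open>d n\<close> at \<open>c (Suc n)\<close>.  Below each \<open>c m\<close> it
  satisfies a Lipschitz condition, and every upper bound of \<open>c\<close> has
  a neighbourhood of upper bounds; so \<open>f\<close> is continuous.
\<close>

lemma CC_BVT_imp_MCP:
  assumes cc: "CC TYPE('a::linordered_field)" and bvt: "BVT TYPE('a)"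
  shows "MCP TYPE('a)"
  unfolding MCP_def
proof (intro allI impI, rule ccontr)
  fix c :: "nat \<Rightarrow> 'a"
  assume "incseq c \<and> bdd_above (range c)" and nc: "\<nexists>l. fld_converges_to c l"
  then have inc: "incseq c" and "bdd_above (range c)" by auto
  then obtain B where B: "\<And>n. c n \<le> B" by (auto simp: bdd_above_def)
  obtain d :: "nat \<Rightarrow> 'a" where d: "incseq d" "\<And>n. 0 \<le> d n" "\<And>x. \<exists>n. x < d n"
    using CC_cofinal_sequence[OF cc] by blast
  \<comment> \<open>Where \<open>c\<close> stands still, division by zero yields \<open>s n = 0\<close> and the slope of \<open>f\<close> does
    not change there.\<close>
  define s where "s n = d n / (c (Suc n) - c n)" for n
  have s_nonneg: "0 \<le> s n" for n
    unfolding s_def using d(2) inc by (simp add: incseq_Suc_iff)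
  define g where "g m x = (\<Sum>n<m. s n * max 0 (x - c n))" for m x
  \<comment> \<open>One formula covers both sides of the gap: for an upper bound \<open>x\<close> the index set is infinite,
    and the sum over an infinite set is 0 by convention.\<close>
  define f where "f x = (\<Sum>n | c n < x. s n * (x - c n))" for x
  have f_below: "f x = g m x" if "x < c m" for x m
    unfolding f_def g_def
  proof (rule sum.mono_neutral_cong_left)
    show "{n. c n < x} \<subseteq> {..<m}"
    proof
      fix n assume "n \<in> {n. c n < x}"
      then have "c n < c m" using that by auto
      then show "n \<in> {..<m}" using inc by (metis incseqD lessThan_iff not_le)
    qed
  qed auto
  have f_above: "f x = 0" if ub: "\<And>n. c n \<le> x" for x
  proof -
    obtain y where "y < x" "\<And>n. c n \<le> y"
      using not_convergent_no_least_upper_bound[OF inc nc ub] by blast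
    then have "{n. c n < x} = UNIV" using le_less_trans by blast
    then show ?thesis by (simp add: f_def)
  qed
  have lipschitz: "\<bar>g m x - g m y\<bar> \<le> (\<Sum>n<m. s n) * \<bar>x - y\<bar>" for m x y
  proof -
    have "\<bar>g m x - g m y\<bar> = \<bar>\<Sum>n<m. s n * (max 0 (x - c n) - max 0 (y - c n))\<bar>"
      by (simp add: g_def sum_subtractf right_diff_distrib)
    also have "\<dots> \<le> (\<Sum>n<m. \<bar>s n * (max 0 (x - c n) - max 0 (y - c n))\<bar>)" by (rule sum_abs)
    also have "\<dots> \<le> (\<Sum>n<m. s n * \<bar>x - y\<bar>)"
    proof (rule sum_mono)
      fix n
      have "\<bar>max 0 (x - c n) - max 0 (y - c n)\<bar> \<le> \<bar>x - y\<bar>"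
        by (auto simp: max_def abs_if)
      then show "\<bar>s n * (max 0 (x - c n) - max 0 (y - c n))\<bar> \<le> s n * \<bar>x - y\<bar>"
        using s_nonneg[of n] by (simp add: abs_mult mult_left_mono)
    qed
    finally show ?thesis by (simp add: sum_distrib_right)
  qed
  have "fld_continuous_on {c 0..B} f"
    unfolding fld_continuous_on_def
  proof (intro ballI allI impI)
    fix z \<epsilon> assume "z \<in> {c 0..B}" and "\<epsilon> > (0::'a)"
    show "\<exists>\<delta>>0. \<forall>x\<in>{c 0..B}. \<bar>x - z\<bar> < \<delta> \<longrightarrow> \<bar>f x - f z\<bar> < \<epsilon>"
    proof (cases "\<exists>m. z < c m")
      case True
      then obtain m where m: "z < c m" by blast
      \<comment> \<open>The 1 makes the Lipschitz constant positive.\<close>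
      define K where "K = (\<Sum>n<m. s n) + 1"
      have "K > 0" unfolding K_def using s_nonneg by (intro add_nonneg_pos sum_nonneg) auto
      define \<delta> where "\<delta> = min (c m - z) (\<epsilon> / K)"
      have "\<delta> > 0" using m \<open>\<epsilon> > 0\<close> \<open>K > 0\<close> by (simp add: \<delta>_def)
      moreover have "\<bar>f x - f z\<bar> < \<epsilon>" if x: "\<bar>x - z\<bar> < \<delta>" for x
      proof -
        have "x < c m" using x by (auto simp: \<delta>_def abs_less_iff)
        then have "\<bar>f x - f z\<bar> \<le> (\<Sum>n<m. s n) * \<bar>x - z\<bar>"
          using f_below m lipschitz by simp
        also have "\<dots> \<le> K * \<bar>x - z\<bar>" unfolding K_def by (intro mult_right_mono) auto
        also have "\<dots> < K * (\<epsilon> / K)"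
          using x \<open>K > 0\<close> by (intro mult_strict_left_mono) (auto simp: \<delta>_def)
        also have "\<dots> = \<epsilon>" using \<open>K > 0\<close> by simp
        finally show ?thesis .
      qed
      ultimately show ?thesis by blast
    next
      case False
      then have "\<And>n. c n \<le> z" by (simp add: not_less)
      then obtain y where y: "y < z" "\<And>n. c n \<le> y"
        using not_convergent_no_least_upper_bound[OF inc nc] by blast
      have "\<bar>f x - f z\<bar> < \<epsilon>" if "\<bar>x - z\<bar> < z - y" for x
      proof -
        have "y < x" using that by (auto simp: abs_less_iff)
        then have "f x = 0" "f z = 0"
          using y by (meson f_above less_imp_le order_trans)+
        then show ?thesis using \<open>\<epsilon> > 0\<close> by simp
      qed
      then show ?thesis using y(1) by (intro exI[of _ "z - y"]) auto
    qed
  qed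
  then obtain M where M: "\<And>x. c 0 \<le> x \<Longrightarrow> x \<le> B \<Longrightarrow> f x \<le> M"
    using bvt[unfolded BVT_def, rule_format, OF conjI[OF B[of 0]]] by blast
  obtain k where k: "M < d k" using d(3) by blast
  \<comment> \<open>A sequence without a limit is not eventually constant.\<close>
  have jump: "\<exists>n\<ge>k. c n < c (Suc n)" for k
  proof (rule ccontr)
    assume "\<not> (\<exists>n\<ge>k. c n < c (Suc n))"
    then have step: "c (Suc n) = c n" if "n \<ge> k" for n
      using inc that by (metis incseq_Suc_iff le_less)
    have const: "c n = c k" if "n \<ge> k" for n
      using that by (induction rule: dec_induct) (auto simp: step)
    have "fld_converges_to c (c k)" unfolding fld_converges_to_def
    proof (intro allI impI exI)
      fix \<epsilon> :: 'a and n assume "\<epsilon> > 0" "k \<le> n"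
      then show "\<bar>c n - c k\<bar> < \<epsilon>" using const[of n] by simp
    qed
    then show False using nc by blast
  qed
  obtain n where n: "n \<ge> k" "c n < c (Suc n)" using jump by blast
  \<comment> \<open>Evaluating at \<open>c m\<close> with \<open>c m < c (Suc m)\<close> makes \<open>f\<close> agree there with the finite sum
    \<open>g (Suc m)\<close>.\<close>
  obtain m where m: "m \<ge> Suc n" "c m < c (Suc m)" using jump by blast
  have "d n = s n * max 0 (c (Suc n) - c n)" using n(2) by (simp add: s_def)
  also have "\<dots> \<le> s n * max 0 (c m - c n)"
    using inc m(1) s_nonneg by (intro mult_left_mono max.mono) (auto simp: incseqD)
  also have "\<dots> \<le> g (Suc m) (c m)"
    unfolding g_def using m(1) s_nonneg
    by (intro member_le_sum[of n _ "\<lambda>n. s n * max 0 (c m - c n)"]) auto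
  also have "\<dots> = f (c m)" using f_below m(2) by simp
  also have "\<dots> \<le> M" using M B inc by (simp add: incseqD)
  finally show False using k d(1) n(1) by (meson incseqD less_le_trans not_le)
qed

text \<open>
  Consecutive natural numbers differ by 1, so they cannot both be within 1/2 of a limit.
\<close>

lemma MCP_imp_AP:
  assumes mcp: "MCP TYPE('a::linordered_field)"
  shows "AP TYPE('a)"
proof (rule ccontr)
  assume "\<not> AP TYPE('a)"
  then have "bdd_above (range (of_nat :: nat \<Rightarrow> 'a))"
    unfolding AP_iff_of_nat_unbounded bdd_above_def by (auto simp: not_less)
  moreover have "incseq (of_nat :: nat \<Rightarrow> 'a)" by (simp add: incseq_def)
  ultimately obtain l :: 'a where "fld_converges_to of_nat l"
    using mcp[unfolded MCP_def, rule_format, OF conjI] by blast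
  then obtain N where "\<And>n. n \<ge> N \<Longrightarrow> \<bar>of_nat n - l\<bar> < 1 / 2"
    unfolding fld_converges_to_def by (meson half_gt_zero zero_less_one)
  from this[of N] this[of "Suc N"] show False
    by (auto simp: abs_if split: if_splits)
qed

text \<open>
  The left endpoints increase and are bounded by every right endpoint, so their limit lies
  in every interval.
\<close>

lemma MCP_imp_weak_NIP:
  assumes mcp: "MCP TYPE('a::linordered_field)"
  shows "weak_NIP TYPE('a)"
  unfolding weak_NIP_def
proof (intro allI impI)
  fix a b :: "nat \<Rightarrow> 'a"
  assume "nested_intervals a b \<and> fld_converges_to (\<lambda>k. b k - a k) 0"
  then have ab: "\<And>k. a k \<le> b k" "\<And>k. {a (Suc k)..b (Suc k)} \<subseteq> {a k..b k}"
    by (auto simp: nested_intervals_def)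
  have inc: "incseq a" unfolding incseq_Suc_iff using ab by (metis atLeastatMost_subset_iff)
  have dec: "decseq b" unfolding decseq_Suc_iff using ab by (metis atLeastatMost_subset_iff)
  have le: "a j \<le> b k" for j k
  proof -
    have "a j \<le> a (max j k)" using inc by (rule incseqD) simp
    also have "\<dots> \<le> b (max j k)" by (rule ab(1))
    also have "\<dots> \<le> b k" using dec by (rule decseqD) simp
    finally show ?thesis .
  qed
  then have "bdd_above (range a)" by (auto simp: bdd_above_def)
  then obtain l where l: "fld_converges_to a l" 
    using mcp[unfolded MCP_def, rule_format, OF conjI[OF inc]] by blast
  have "a k \<le> l" for k
  proof (rule ccontr)
    assume "\<not> a k \<le> l"
    then obtain N where N: "\<And>n. n \<ge> N \<Longrightarrow> \<bar>a n - l\<bar> < a k - l"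
      using l unfolding fld_converges_to_def by (metis diff_gt_0_iff_gt not_le)
    then have "a (max N k) < a k" using N[of "max N k"] by (simp add: abs_less_iff)
    then show False using inc by (metis incseqD max.cobounded2 not_le)
  qed
  moreover have "l \<le> b k" for k
  proof (rule ccontr)
    assume "\<not> l \<le> b k"
    then obtain N where "\<bar>a N - l\<bar> < l - b k"
      using l unfolding fld_converges_to_def by (metis diff_gt_0_iff_gt not_le order_refl)
    then show False using le[of N k] by (simp add: abs_if split: if_splits)
  qed
  ultimately have "l \<in> (\<Inter>k. {a k..b k})" by simp
  then show "(\<Inter>k. {a k..b k}) \<noteq> {}" by blast
qed

section \<open>The equivalence\<close>

theorem theorem81:
  shows "((AP TYPE('a::linordered_field) \<and> weak_NIP TYPE('a)) \<longleftrightarrow> fld_compact {0..1::'a}) \<and>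
    (fld_compact {0..1::'a} \<longleftrightarrow> (AP TYPE('a) \<and> LCL TYPE('a))) \<and>
    ((AP TYPE('a) \<and> LCL TYPE('a)) \<longleftrightarrow> (AP TYPE('a) \<and> UCT TYPE('a))) \<and>
    ((AP TYPE('a) \<and> UCT TYPE('a)) \<longleftrightarrow> UAS TYPE('a)) \<and>
    (UAS TYPE('a) \<longleftrightarrow> (CC TYPE('a) \<and> BVT TYPE('a))) \<and>
    ((CC TYPE('a) \<and> BVT TYPE('a)) \<longleftrightarrow> MCP TYPE('a))"
proof -
  have "LCL TYPE('a)" if "fld_compact {0..1::'a}"
    using compact_unit_imp_compact_interval[OF that] compact_imp_lebesgue_number
    unfolding LCL_def by blast
  then show ?thesis
    using AP_weak_NIP_imp_compact[where 'a = 'a] compact_unit_imp_AP[where 'a = 'a]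
      LCL_imp_UCT[where 'a = 'a] AP_UCT_imp_UAS[where 'a = 'a] UAS_imp_AP[where 'a = 'a]
      UAS_imp_BVT[where 'a = 'a] AP_imp_CC[where 'a = 'a] CC_BVT_imp_MCP[where 'a = 'a]
      MCP_imp_AP[where 'a = 'a] MCP_imp_weak_NIP[where 'a = 'a]
    by blast
qed

end
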